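(* Let $n\ge 3$ and $k\ge 1$ be integers, and consider a degenerated magic polygon $D(n,k)$ with magic sum $u$ and value $c$ assigned to the root vertex. For $j\in\{1,\dots,k\}$ let $S_j=\sum_{t=1}^{k}\sum_{i=1}^{n-2}x_{t,(i-1)k+j}$ be the sum of the values assigned to the $j$-th points (clockwise) of all the edges not adjacent to the root vertex. Then: (i) $u=(k+1)\dfrac{k^2(n-2)+k+2}{2}$; (ii) $c=\dfrac{k^2(n-2)+k+2}{2}$; (iii) $S_j=(n-2)k\,\dfrac{k^2(n-2)+k+2}{2}$ for every $j\in\{1,\dots,k\}$.
   Context: Degenerated magic polygon $D(n,k)$: take $k$ regular $n$-gons of distinct sizes sharing a common vertex $C$ (the root vertex), nested so that they are homothetic with center $C$. On each of the $n-2$ edges of each polygon not adjacent to $C$ there are $k-1$ intermediate points besides the two end vertices. Thus the $t$-th polygon ($1\le t\le k$) carries, besides $C$, the points $P_{t,m}$, $1\le m\le k(n-2)+1$, listed clockwise; the vertices other than $C$ are those with $m\equiv1\pmod k$, i.e. $m=1,k+1,\dots,k(n-2)+1$, and the $i$-th edge not adjacent to $C$ ($1\le i\le n-2$) consists of the $k+1$ points $P_{t,(i-1)k+1},\dots,P_{t,ik+1}$. Points with the same $m$ lie on a common segment from $C$. Together with $C$ there are $k^2(n-2)+k+1$ points. They are labeled bijectively by $1,2,\dots,k^2(n-2)+k+1$; let $x_{t,m}$ be the label of $P_{t,m}$ and $c$ the label of $C$. The labeled configuration is a degenerated magic polygon $D(n,k)$ if there is a fixed value $u$ (the magic sum) such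 that: (a) for all $1\le t\le k$ and $1\le i\le n-2$, $\sum_{s=1}^{k+1}x_{t,(i-1)k+s}=u$; (b) for all $1\le m\le k(n-2)+1$, $\sum_{t=1}^{k}x_{t,m}+c=u$. *)

theory Defs
  imports "HOL-Analysis.Analysis"
begin

text \<open>
  The plane is the type \<^typ>\<open>complex\<close>. \<open>ngon_vertex n C z j\<close> is the \<open>j\<close>-th vertex,
  counted clockwise from \<open>C\<close> (which is vertex number \<open>0\<close>), of the regular \<open>n\<close>-gon
  with centre \<open>z\<close> that has \<open>C\<close> as a vertex.
\<close>

definition ngon_vertex :: "nat \<Rightarrow> complex \<Rightarrow> complex \<Rightarrow> nat \<Rightarrow> complex" where
  "ngon_vertex n C z j = z + (C - z) * cis (- (2 * pi * real j / real n))"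

text \<open>
  \<open>nested_ngons n k C P\<close>: the points \<open>P t m\<close> (\<open>1 \<le> t \<le> k\<close>, \<open>1 \<le> m \<le> k (n - 2) + 1\<close>)
  are the points other than \<open>C\<close> of \<open>k\<close> regular \<open>n\<close>-gons sharing the vertex \<open>C\<close>. The
  \<open>t\<close>-th polygon has centre \<open>C + r t *\<^sub>R w\<close>; hence all polygons are homothetic from \<open>C\<close>
  with positive ratios, and injectivity of \<open>r\<close> makes their sizes distinct.
  The third conjunct says that the points of the \<open>i\<close>-th edge not adjacent to \<open>C\<close> occur on
  it in the order of their indices, with \<open>k - 1\<close> of them strictly between its end vertices.
\<close>

definition nested_ngons ::
    "nat \<Rightarrow> nat \<Rightarrow> complex \<Rightarrow> (nat \<Rightarrow> nat \<Rightarrow> complex) \<Rightarrow> bool" where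
  "nested_ngons n k C P \<longleftrightarrow>
     (\<exists>w r. w \<noteq> 0 \<and> inj_on r {1..k} \<and> (\<forall>t\<in>{1..k}. (0::real) < r t) \<and>
        (\<forall>t\<in>{1..k}. \<forall>i\<in>{1..n-1}.
           P t ((i-1)*k + 1) = ngon_vertex n C (C + r t *\<^sub>R w) i)) \<and>
     (\<forall>t\<in>{1..k}. \<forall>i\<in>{1..n-2}. \<forall>s s'. 1 < s \<and> s < s' \<and> s' \<le> k + 1 \<longrightarrow>
        P t ((i-1)*k + s) \<in> open_segment (P t ((i-1)*k + 1)) (P t ((i-1)*k + s'))) \<and>
     (\<forall>m\<in>{1..k*(n-2)+1}. \<exists>e. \<forall>t\<in>{1..k}. P t m \<in> closed_segment C e)"

definition config_points ::
    "nat \<Rightarrow> nat \<Rightarrow> complex \<Rightarrow> (nat \<Rightarrow> nat \<Rightarrow> complex) \<Rightarrow> complex set" where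
  "config_points n k C P = insert C {P t m | t m. t \<in> {1..k} \<and> m \<in> {1..k*(n-2)+1}}"

definition degenerated_magic_polygon ::
    "nat \<Rightarrow> nat \<Rightarrow> complex \<Rightarrow> (nat \<Rightarrow> nat \<Rightarrow> complex) \<Rightarrow> (complex \<Rightarrow> nat) \<Rightarrow> nat \<Rightarrow> bool" where
  "degenerated_magic_polygon n k C P label u \<longleftrightarrow>
     nested_ngons n k C P \<and>
     bij_betw label (config_points n k C P) {1..k^2*(n-2) + k + 1} \<and>
     (\<forall>t\<in>{1..k}. \<forall>i\<in>{1..n-2}. (\<Sum>s=1..k+1. label (P t ((i-1)*k + s))) = u) \<and>
     (\<forall>m\<in>{1..k*(n-2)+1}. (\<Sum>t=1..k. label (P t m)) + label C = u)"

definition position_sum ::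
    "nat \<Rightarrow> nat \<Rightarrow> (nat \<Rightarrow> nat \<Rightarrow> complex) \<Rightarrow> (complex \<Rightarrow> nat) \<Rightarrow> nat \<Rightarrow> nat" where
  "position_sum n k P label j = (\<Sum>t=1..k. \<Sum>i=1..n-2. label (P t ((i-1)*k + j)))"

end

theory Submission
  imports Defs
begin

text \<open>
  The proof is double counting on a \<open>k \<times> l\<close> grid of labels with \<open>l = k * (n - 2) + 1\<close>: rows
  are polygons and columns are the segments through \<open>C\<close>. Write \<open>N = k * l + 1\<close> for the
  number of points.

  Every column has sum \<open>u - c\<close>, and the \<open>j\<close>-th points of the edges fill exactly \<open>n - 2\<close>
  columns, so \<open>S\<^sub>j = (n - 2) (u - c)\<close>, and this holds for \<open>j = k + 1\<close> too. Adding all edge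
  sums position by position gives \<open>k (n - 2) u = (k + 1) (n - 2) (u - c)\<close>, that is
  \<open>u = (k + 1) c\<close>; shared vertices are counted twice on both sides, so they need no
  correction. This is lemma \<open>edge_and_column_sums\<close>. Adding all columns gives
  \<open>N (N + 1) / 2 = c + l (u - c) = (1 + l k) c = N c\<close>, which determines \<open>c\<close>, then \<open>u\<close> and
  every \<open>S\<^sub>j\<close>.

  The last count requires the points \<open>P t m\<close> and \<open>C\<close> to be pairwise distinct. The reason is
  cardinality: the labels biject the configuration with a set of \<open>N\<close> numbers, and only \<open>N\<close>
  names are available for its points, so no two names denote the same point. Lemma
  \<open>sum_insert_image_if_card_maximal\<close> turns this into the formula for the total.
\<close>

text \<open>
  Here the family \<open>f\<close> on \<open>I\<close> together with \<open>a\<close> takes as many distinct values as it has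
  indices, so its values cannot repeat.
\<close>

lemma sum_insert_image_if_card_maximal:
  fixes g :: "'b \<Rightarrow> 'c::comm_monoid_add"
  assumes "finite I" and "card (insert a (f ` I)) = Suc (card I)"
  shows "sum g (insert a (f ` I)) = g a + (\<Sum>i\<in>I. g (f i))"
proof -
  have "card (f ` I) \<le> card I"
    using assms(1) by (rule card_image_le)
  with assms have a: "a \<notin> f ` I" and "card (f ` I) = card I"
    by (auto simp: card_insert_if split: if_splits)
  then have "inj_on f I"
    using assms(1) by (simp add: eq_card_imp_inj_on)
  with a assms(1) show ?thesis
    by (simp add: sum.reindex)
qed

lemma edge_position_in_range:
  fixes i k q s :: nat
  assumes "i \<in> {1..q}" and "s \<in> {1..k + 1}"
  shows "(i - 1) * k + s \<in> {1..k * q + 1}"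
proof -
  obtain i' where i': "i = Suc i'" "Suc i' \<le> q"
    using assms(1) by (cases i) auto
  have "Suc i' * k \<le> q * k"
    using i'(2) by (rule mult_le_mono1)
  with i' assms(2) show ?thesis
    by (auto simp: mult.commute)
qed

text \<open>
  The second conclusion evaluates the sum of all edge sums in two ways, the second time by
  means of the first conclusion for all \<open>k + 1\<close> positions of an edge.
\<close>

lemma edge_and_column_sums:
  fixes x :: "nat \<Rightarrow> nat \<Rightarrow> real"
  assumes "q \<ge> 1"
    and edges: "\<And>t i. t \<in> {1..k} \<Longrightarrow> i \<in> {1..q} \<Longrightarrow>
      (\<Sum>s=1..k+1. x t ((i - 1) * k + s)) = u"
    and columns: "\<And>m. m \<in> {1..k * q + 1} \<Longrightarrow> (\<Sum>t=1..k. x t m) + c = u"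
  shows "\<And>j. j \<in> {1..k + 1} \<Longrightarrow>
      (\<Sum>t=1..k. \<Sum>i=1..q. x t ((i - 1) * k + j)) = real q * (u - c)"
    and "u = (real k + 1) * c"
proof -
  show position: "(\<Sum>t=1..k. \<Sum>i=1..q. x t ((i - 1) * k + j)) = real q * (u - c)"
    if j: "j \<in> {1..k + 1}" for j
  proof -
    have "(\<Sum>t=1..k. \<Sum>i=1..q. x t ((i - 1) * k + j))
        = (\<Sum>i=1..q. \<Sum>t=1..k. x t ((i - 1) * k + j))"
      by (rule sum.swap)
    also have "\<dots> = (\<Sum>i=1..q. u - c)"
      using columns[OF edge_position_in_range[OF _ j]]
      by (intro sum.cong refl) (simp add: eq_diff_eq)
    finally show ?thesis
      by simp
  qed
  have "real k * (real q * u) = (\<Sum>t=1..k. \<Sum>i=1..q. \<Sum>s=1..k+1. x t ((i - 1) * k + s))"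
    using edges by simp
  also have "\<dots> = (\<Sum>t=1..k. \<Sum>s=1..k+1. \<Sum>i=1..q. x t ((i - 1) * k + s))"
    by (intro sum.cong refl sum.swap)
  also have "\<dots> = (\<Sum>s=1..k+1. \<Sum>t=1..k. \<Sum>i=1..q. x t ((i - 1) * k + s))"
    by (rule sum.swap)
  also have "\<dots> = (\<Sum>s=1..k+1. real q * (u - c))"
    by (intro sum.cong refl position)
  also have "\<dots> = (real k + 1) * (real q * (u - c))"
    by simp
  finally have "real q * (real k * u) = real q * ((real k + 1) * (u - c))"
    by (simp only: mult.left_commute)
  then have "real k * u = (real k + 1) * (u - c)"
    using \<open>q \<ge> 1\<close> by simp
  then show "u = (real k + 1) * c"
    by (simp add: algebra_simps)
qed

theorem theorem6:
  fixes n k u c :: nat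
    and C :: complex
    and P :: "nat \<Rightarrow> nat \<Rightarrow> complex"
    and label :: "complex \<Rightarrow> nat"
  assumes "n \<ge> 3" and "k \<ge> 1"
    and "degenerated_magic_polygon n k C P label u"
    and "c = label C"
  shows "real u = (real k + 1) * ((real k ^ 2 * (real n - 2) + real k + 2) / 2) \<and>
    real c = (real k ^ 2 * (real n - 2) + real k + 2) / 2 \<and>
    (\<forall>j\<in>{1..k}. real (position_sum n k P label j) =
        (real n - 2) * real k * ((real k ^ 2 * (real n - 2) + real k + 2) / 2))"
proof -
  define q where "q = n - 2"
  define l where "l = k * q + 1"
  define N where "N = k * l + 1"
  define x where "x t m = real (label (P t m))" for t m
  have q: "q \<ge> 1" "real q = real n - 2"
    using \<open>n \<ge> 3\<close> by (auto simp: q_def)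
  have bij: "bij_betw label (config_points n k C P) {1..N}"
    and edges: "\<And>t i. t \<in> {1..k} \<Longrightarrow> i \<in> {1..q} \<Longrightarrow>
      (\<Sum>s=1..k+1. label (P t ((i - 1) * k + s))) = u"
    and columns: "\<And>m. m \<in> {1..l} \<Longrightarrow> (\<Sum>t=1..k. label (P t m)) + c = u"
    using assms(3,4)
    by (auto simp: degenerated_magic_polygon_def q_def l_def N_def power2_eq_square algebra_simps)
  have x_edges: "(\<Sum>s=1..k+1. x t ((i - 1) * k + s)) = real u"
    if "t \<in> {1..k}" "i \<in> {1..q}" for t i
    unfolding x_def of_nat_sum[symmetric] using edges[OF that] by (rule arg_cong)
  have x_columns: "(\<Sum>t=1..k. x t m) + real c = real u" if "m \<in> {1..k * q + 1}" for m
    unfolding x_def of_nat_sum[symmetric] of_nat_add[symmetric]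
    using columns[OF that[folded l_def]] by (rule arg_cong)
  note sums = edge_and_column_sums[of q k x "real u" "real c", OF q(1) x_edges x_columns]

  let ?I = "{1..k} \<times> {1..l}"
  have points: "config_points n k C P = insert C (case_prod P ` ?I)"
    by (force simp: config_points_def l_def q_def)
  have "card (insert C (case_prod P ` ?I)) = Suc (card ?I)"
    using bij_betw_same_card[OF bij] by (simp add: points N_def)
  then have "(\<Sum>p\<in>config_points n k C P. real (label p))
      = real c + (\<Sum>i\<in>?I. real (label (case_prod P i)))"
    unfolding points \<open>c = label C\<close> by (intro sum_insert_image_if_card_maximal) auto
  also have "(\<Sum>i\<in>?I. real (label (case_prod P i))) = (\<Sum>t=1..k. \<Sum>m=1..l. x t m)"
    by (simp add: sum.cartesian_product x_def case_prod_unfold)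
  also have "\<dots> = (\<Sum>m=1..l. \<Sum>t=1..k. x t m)"
    by (rule sum.swap)
  also have "\<dots> = (\<Sum>m=1..l. real u - real c)"
    using x_columns by (intro sum.cong refl) (simp add: eq_diff_eq l_def)
  also have "\<dots> = real l * (real k * real c)"
    using sums(2) by (simp add: algebra_simps)
  finally have "(\<Sum>p\<in>config_points n k C P. real (label p)) = real N * real c"
    by (simp add: N_def algebra_simps)
  moreover have "(\<Sum>p\<in>config_points n k C P. real (label p)) = (\<Sum>v=1..N. real v)"
    by (rule sum.reindex_bij_betw[OF bij])
  moreover have "2 * (\<Sum>v=1..N. real v) = real N * (real N + 1)"
    using double_gauss_sum_from_Suc_0[of N, where 'a = real] by simp
  ultimately have "real N * (2 * real c) = real N * (real N + 1)"
    by simp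
  then have "2 * real c = real N + 1"
    by (simp add: N_def del: of_nat_Suc of_nat_add)
  then have c: "real c = (real k ^ 2 * (real n - 2) + real k + 2) / 2"
    by (simp add: N_def l_def q(2)[symmetric] power2_eq_square algebra_simps)
  have "real (position_sum n k P label j) = (real n - 2) * real k * real c"
    if "j \<in> {1..k}" for j
  proof -
    have "real (position_sum n k P label j) = real q * (real u - real c)"
      using sums(1)[of j] that by (simp add: position_sum_def x_def q_def)
    also have "\<dots> = real q * (real k * real c)"
      using sums(2) by (simp add: algebra_simps)
    finally show ?thesis
      by (simp add: q(2))
  qed
  with c sums(2) show ?thesis
    by simp
qed

end
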